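(* Let $s \geq 1$ and $t \geq 2$ be integers and let $\beta_{s,t}$ be the type-$\beta$ comb with $s$ teeth of length $t$. Then the number of linear extensions of $\beta_{s,t}$ that avoid both patterns $312$ and $321$ equals $(t+1)^{s-1}$.
   Context: A linear extension of a finite poset $P$ on a set of integers is a listing $v=[v_1,\dots,v_n]$ of all elements of $P$, each exactly once, such that whenever $a \leq_P b$, $a$ appears before $b$. For $w \in S_3$, a sequence $v$ of distinct integers contains $w$ if there are indices $i<j<k$ with $(v_i,v_j,v_k)$ in the same relative order as $(w_1,w_2,w_3)$; otherwise $v$ avoids $w$. The type-$\beta$ comb $\beta_{s,t}$ is the poset on $\{1,\dots,st\}$ whose order is generated by the relations $ct+1 \leq (c+1)t+1$ for $0 \leq c \leq s-2$ (the spine) and $ct+j \leq ct+j+1$ for $0 \leq c \leq s-1$, $1 \leq j \leq t-1$ (the teeth $\{ct+1,\dots,ct+t\}$). *)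

theory Defs
  imports Main
begin

text \<open>A poset is a carrier \<open>A\<close> together with its reflexive order relation \<open>r\<close>.
  The index condition says that a strictly smaller element occurs strictly earlier,
  since the entries are distinct and the case \<open>i = j\<close> is the reflexive pair.\<close>

definition linear_extension :: "'a set \<Rightarrow> 'a rel \<Rightarrow> 'a list \<Rightarrow> bool" where
  "linear_extension A r v \<longleftrightarrow>
     distinct v \<and> set v = A \<and>
     (\<forall>i < length v. \<forall>j < length v. (v ! i, v ! j) \<in> r \<longrightarrow> i \<le> j)"

definition same_relative_order :: "'a::linorder list \<Rightarrow> 'b::linorder list \<Rightarrow> bool" where
  "same_relative_order x w \<longleftrightarrow>
     length x = length w \<and>
     (\<forall>i < length w. \<forall>j < length w. x ! i < x ! j \<longleftrightarrow> w ! i < w ! j)"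

text \<open>Patterns \<open>w\<close> of length three, in one-line notation.\<close>

definition contains_pattern :: "'a::linorder list \<Rightarrow> nat list \<Rightarrow> bool" where
  "contains_pattern v w \<longleftrightarrow>
     (\<exists>i j k. i < j \<and> j < k \<and> k < length v \<and> same_relative_order [v ! i, v ! j, v ! k] w)"

definition avoids :: "'a::linorder list \<Rightarrow> nat list \<Rightarrow> bool" where
  "avoids v w \<longleftrightarrow> \<not> contains_pattern v w"

text \<open>The bound \<open>c \<le> s - 2\<close> is written \<open>c + 2 \<le> s\<close>, and \<open>j \<le> t - 1\<close> as \<open>j + 1 \<le> t\<close>,
  to avoid truncated subtraction; in particular there is no spine relation when \<open>s = 1\<close>.\<close>

definition comb_spine :: "nat \<Rightarrow> nat \<Rightarrow> nat rel" where
  "comb_spine s t = {(c * t + 1, (c + 1) * t + 1) | c. c + 2 \<le> s}"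

definition comb_teeth :: "nat \<Rightarrow> nat \<Rightarrow> nat rel" where
  "comb_teeth s t = {(c * t + j, c * t + j + 1) | c j. c + 1 \<le> s \<and> 1 \<le> j \<and> j + 1 \<le> t}"

definition comb_carrier :: "nat \<Rightarrow> nat \<Rightarrow> nat set" where
  "comb_carrier s t = {1..s * t}"

definition comb_order :: "nat \<Rightarrow> nat \<Rightarrow> nat rel" where
  "comb_order s t = Id_on (comb_carrier s t) \<union> (comb_spine s t \<union> comb_teeth s t)\<^sup>+"

lemma comb_generators_subset:
  assumes "t \<ge> 1"
  shows "comb_spine s t \<union> comb_teeth s t \<subseteq> comb_carrier s t \<times> comb_carrier s t"
proof -
  have "c * t + j + 1 \<le> s * t" if "c + 1 \<le> s" "j + 1 \<le> t" for c j
    using mult_le_mono1[OF that(1), of t] that(2) by (simp add: algebra_simps)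
  moreover have "(c + 1) * t + 1 \<le> s * t" if "c + 2 \<le> s" for c
    using mult_le_mono1[OF that, of t] assms by (simp add: algebra_simps)
  ultimately show ?thesis
    by (fastforce simp: comb_spine_def comb_teeth_def comb_carrier_def)
qed

lemma comb_partial_order:
  assumes "t \<ge> 1"
  shows "partial_order_on (comb_carrier s t) (comb_order s t)"
proof -
  let ?g = "comb_spine s t \<union> comb_teeth s t" and ?A = "comb_carrier s t"
  have sub: "?g\<^sup>+ \<subseteq> ?A \<times> ?A"
    using comb_generators_subset[OF assms] by (rule trancl_subset_Sigma)
  have "?g \<subseteq> {(a, b). a < b}"
    using assms by (auto simp: comb_spine_def comb_teeth_def)
  then have "?g\<^sup>+ \<subseteq> {(a, b). a < b}\<^sup>+"
    by (blast intro: trancl_mono)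
  also have "\<dots> = {(a, b). a < b}"
    by (intro trancl_id transI) auto
  finally have lt: "a < b" if "(a, b) \<in> ?g\<^sup>+" for a b
    using that by blast
  have "refl_on ?A (comb_order s t)"
    using sub by (auto simp: refl_on_def comb_order_def)
  moreover have "trans (comb_order s t)"
    by (rule transI) (auto simp: comb_order_def intro: trancl_trans)
  moreover have "antisym (comb_order s t)"
  proof (rule antisymI)
    fix a b
    assume "(a, b) \<in> comb_order s t" "(b, a) \<in> comb_order s t"
    then have "a = b \<or> (a < b \<and> b < a)"
      unfolding comb_order_def using lt[of a b] lt[of b a] by blast
    then show "a = b" by auto
  qed
  ultimately show ?thesis
    using sub by (auto simp: partial_order_on_def preorder_on_def comb_order_def)
qed

end

theory Submission
  imports Defs "HOL-Library.Sublist"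
begin

text \<open>
  A sequence avoids \<open>312\<close> and \<open>321\<close> iff no entry is followed by two smaller ones. Hence the
  largest entry \<open>n + 1\<close> is last or second to last, and every such sequence arises from a unique one
  on \<open>{1..n}\<close> by inserting \<open>n + 1\<close> at the end or just before the last entry; the latter respects the
  comb iff the last entry is not covered by \<open>n + 1\<close>. The last entry is always \<open>n\<close> or the tip of a
  tooth. So \<open>n + 1\<close> can be inserted before the last entry always if it starts a new tooth, and
  otherwise iff the last entry differs from \<open>n\<close>. If \<open>T\<close> sequences exist before a tooth is added, its
  first element makes \<open>2 T\<close> of them, \<open>T\<close> not ending in their maximum, and each further element adds
  another \<open>T\<close>, so a tooth multiplies the count by \<open>t + 1\<close>.
\<close>

section \<open>Subsequences\<close>

text \<open>The order and pattern conditions are stated with indices, which shift when an entry is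
  inserted; \<open>subseq\<close> is insensitive to such shifts. This and the next two lemmas
  translate between the two views.\<close>

lemma subseq_Cons_iff_nth:
  "subseq (a # us) v \<longleftrightarrow> (\<exists>i < length v. v ! i = a \<and> subseq us (drop (Suc i) v))"
proof
  assume "subseq (a # us) v"
  then obtain xs ys where v: "v = xs @ a # ys" and "subseq us ys"
    by (auto dest: list_emb_ConsD)
  then show "\<exists>i < length v. v ! i = a \<and> subseq us (drop (Suc i) v)"
    by (intro exI[of _ "length xs"]) auto
next
  assume "\<exists>i < length v. v ! i = a \<and> subseq us (drop (Suc i) v)"
  then obtain i where i: "i < length v" "v ! i = a" "subseq us (drop (Suc i) v)"
    by blast
  then have "v = take i v @ a # drop (Suc i) v"
    using id_take_nth_drop[of i v] by simp
  moreover have "subseq (a # us) (take i v @ a # drop (Suc i) v)"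
    using i(3) by (intro list_emb_append2) auto
  ultimately show "subseq (a # us) v" by simp
qed

lemma subseq_pair_iff_nth:
  "subseq [a, b] v \<longleftrightarrow> (\<exists>i j. i < j \<and> j < length v \<and> v ! i = a \<and> v ! j = b)"
proof
  assume "subseq [a, b] v"
  then obtain i k where "i < length v" "v ! i = a" "k < length v - Suc i" "v ! (Suc i + k) = b"
    by (auto simp: subseq_Cons_iff_nth)
  then show "\<exists>i j. i < j \<and> j < length v \<and> v ! i = a \<and> v ! j = b"
    by (intro exI[of _ i] exI[of _ "Suc i + k"]) auto
next
  assume "\<exists>i j. i < j \<and> j < length v \<and> v ! i = a \<and> v ! j = b"
  then obtain i j where "i < j" "j < length v" "v ! i = a" "v ! j = b" by blast
  then show "subseq [a, b] v"
    unfolding subseq_Cons_iff_nth[of a]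
    by (intro exI[of _ i]) (auto simp: subseq_singleton_left in_set_conv_nth
        intro!: exI[of _ "j - Suc i"])
qed

lemma subseq_triple_iff_nth:
  "subseq [a, b, c] v \<longleftrightarrow>
     (\<exists>i j k. i < j \<and> j < k \<and> k < length v \<and> v ! i = a \<and> v ! j = b \<and> v ! k = c)"
proof
  assume "subseq [a, b, c] v"
  then obtain i where i: "i < length v" "v ! i = a" "subseq [b, c] (drop (Suc i) v)"
    unfolding subseq_Cons_iff_nth[of a] by blast
  then obtain j k where "j < k" "k < length v - Suc i" "v ! (Suc i + j) = b" "v ! (Suc i + k) = c"
    by (auto simp: subseq_pair_iff_nth)
  with i show "\<exists>i j k. i < j \<and> j < k \<and> k < length v \<and> v ! i = a \<and> v ! j = b \<and> v ! k = c"
    by (intro exI[of _ i] exI[of _ "Suc i + j"] exI[of _ "Suc i + k"]) auto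
next
  assume "\<exists>i j k. i < j \<and> j < k \<and> k < length v \<and> v ! i = a \<and> v ! j = b \<and> v ! k = c"
  then obtain i j k where *: "i < j" "j < k" "k < length v" "v ! i = a" "v ! j = b" "v ! k = c"
    by blast
  then have "subseq [b, c] (drop (Suc i) v)"
    unfolding subseq_pair_iff_nth
    by (intro exI[of _ "j - Suc i"] exI[of _ "k - Suc i"]) auto
  with * show "subseq [a, b, c] v"
    unfolding subseq_Cons_iff_nth[of a] by (intro exI[of _ i]) auto
qed

text \<open>Filtering out \<open>m\<close> fixes \<open>us\<close> and turns the longer list into
  the shorter one. This handles forbidden subsequences that do not involve the inserted
  maximum.\<close>

lemma subseq_insert_new:
  assumes "m \<notin> set us" "m \<notin> set xs" "m \<notin> set ys"
  shows "subseq us (xs @ m # ys) \<longleftrightarrow> subseq us (xs @ ys)"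
proof
  assume "subseq us (xs @ m # ys)"
  then have "subseq (filter (\<lambda>x. x \<noteq> m) us) (filter (\<lambda>x. x \<noteq> m) (xs @ m # ys))"
    by (rule subseq_filter)
  moreover have "filter (\<lambda>x. x \<noteq> m) zs = zs" if "m \<notin> set zs" for zs
    using that by (auto simp: filter_id_conv)
  ultimately show "subseq us (xs @ ys)" using assms by simp
next
  assume "subseq us (xs @ ys)"
  then show "subseq us (xs @ m # ys)"
    by (rule subseq_order.trans) (auto intro: list_emb_append_mono)
qed

text \<open>Matching the leading \<open>m\<close> at its earliest occurrence loses nothing. This
  handles forbidden subsequences that start with the inserted maximum.\<close>

lemma subseq_Cons_append_new:
  "m \<notin> set xs \<Longrightarrow> subseq (m # us) (xs @ m # ys) \<longleftrightarrow> subseq us ys"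
  by (induction xs) auto

section \<open>Linear extensions in which no entry is followed by two smaller ones\<close>

text \<open>Order and patterns alike become forbidden subsequences, a form inherited by shorter
  lists. The order enters only through its generators \<open>g\<close>.\<close>

definition admissible :: "nat rel \<Rightarrow> nat \<Rightarrow> nat list \<Rightarrow> bool" where
  "admissible g n v \<longleftrightarrow>
     distinct v \<and> set v = {1..n} \<and>
     (\<forall>a b. (a, b) \<in> g \<longrightarrow> \<not> subseq [b, a] v) \<and>
     (\<forall>a b c. b < a \<longrightarrow> c < a \<longrightarrow> \<not> subseq [a, b, c] v)"

text \<open>Pairs of entries in weak order of position form a relation \<open>R\<close>, transitive
  because distinct entries have unique positions. Once \<open>R\<close> contains \<open>g\<close>,
  it contains \<open>g\<^sup>+\<close>.\<close>

lemma linear_extension_generators: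
  assumes "g \<subseteq> A \<times> A" and "irrefl g"
  shows "linear_extension A (Id_on A \<union> g\<^sup>+) v \<longleftrightarrow>
    distinct v \<and> set v = A \<and> (\<forall>a b. (a, b) \<in> g \<longrightarrow> \<not> subseq [b, a] v)"
proof
  assume L: "linear_extension A (Id_on A \<union> g\<^sup>+) v"
  have "\<not> subseq [b, a] v" if "(a, b) \<in> g" for a b
  proof
    assume "subseq [b, a] v"
    then obtain i j where "i < j" "j < length v" "v ! i = b" "v ! j = a"
      by (auto simp: subseq_pair_iff_nth)
    with L that show False
      unfolding linear_extension_def by (metis UnCI less_trans not_less r_into_trancl')
  qed
  with L show "distinct v \<and> set v = A \<and> (\<forall>a b. (a, b) \<in> g \<longrightarrow> \<not> subseq [b, a] v)"
    by (simp add: linear_extension_def)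
next
  assume v: "distinct v \<and> set v = A \<and> (\<forall>a b. (a, b) \<in> g \<longrightarrow> \<not> subseq [b, a] v)"
  define R where "R = {(v ! i, v ! j) | i j. i \<le> j \<and> j < length v}"
  have inj: "v ! i = v ! j \<longleftrightarrow> i = j" if "i < length v" "j < length v" for i j
    using v that by (simp add: nth_eq_iff_index_eq)
  have "g \<subseteq> R"
  proof
    fix p assume p: "p \<in> g"
    then obtain i j where ij: "p = (v ! i, v ! j)" "i < length v" "j < length v"
      using assms(1) v by (metis SigmaE in_set_conv_nth subsetD)
    then have "\<not> j < i"
      using v p unfolding subseq_pair_iff_nth by blast
    then have "i \<le> j" by simp
    then show "p \<in> R" using ij unfolding R_def by blast
  qed
  moreover have "trans R"
  proof (rule transI)
    fix x y z assume "(x, y) \<in> R" "(y, z) \<in> R"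
    then obtain i j k l where "x = v ! i" "y = v ! j" "y = v ! k" "z = v ! l"
      "i \<le> j" "j < length v" "k \<le> l" "l < length v"
      unfolding R_def by blast
    moreover from this have "j = k" using inj[of j k] by auto
    ultimately show "(x, z) \<in> R" unfolding R_def by (auto intro: le_trans)
  qed
  ultimately have R: "g\<^sup>+ \<subseteq> R"
    using trancl_mono trancl_id by blast
  have "i \<le> j" if "i < length v" "j < length v" "(v ! i, v ! j) \<in> Id_on A \<union> g\<^sup>+" for i j
  proof (cases "v ! i = v ! j")
    case True
    then show ?thesis using inj that by simp
  next
    case False
    then have "(v ! i, v ! j) \<in> R" using that(3) R by auto
    then obtain i' j' where "v ! i = v ! i'" "v ! j = v ! j'" "i' \<le> j'" "j' < length v"
      unfolding R_def by blast
    then show ?thesis using inj that by simp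
  qed
  with v show "linear_extension A (Id_on A \<union> g\<^sup>+) v"
    by (simp add: linear_extension_def)
qed

text \<open>Two smaller entries after a larger one form 312 or 321 with it, depending on their
  mutual order; distinctness rules out a tie.\<close>

lemma avoids_312_321_iff:
  assumes "distinct v"
  shows "avoids v [3, 1, 2] \<and> avoids v [3, 2, 1] \<longleftrightarrow>
    (\<forall>a b c. b < a \<longrightarrow> c < a \<longrightarrow> \<not> subseq [a, b, c] v)"
proof -
  have pat: "same_relative_order [x, y, z] [3, 1, 2::nat] \<longleftrightarrow> y < z \<and> z < x"
       "same_relative_order [x, y, z] [3, 2, 1::nat] \<longleftrightarrow> z < y \<and> y < x" for x y z :: 'a
    by (auto simp: same_relative_order_def All_less_Suc numeral_3_eq_3)
  have ne: "v ! j \<noteq> v ! k" if "j < k" "k < length v" for j k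
    using assms that by (simp add: nth_eq_iff_index_eq)
  have "contains_pattern v [3, 1, 2] \<or> contains_pattern v [3, 2, 1] \<longleftrightarrow>
      (\<exists>i j k. i < j \<and> j < k \<and> k < length v \<and> v ! j < v ! i \<and> v ! k < v ! i)"
    (is "?pattern \<longleftrightarrow> ?two")
  proof
    show "?pattern \<Longrightarrow> ?two"
      unfolding contains_pattern_def pat by (blast intro: less_trans)
  next
    assume ?two
    then obtain i j k where *: "i < j" "j < k" "k < length v" "v ! j < v ! i" "v ! k < v ! i"
      by blast
    then have "v ! j < v ! k \<or> v ! k < v ! j" using ne[of j k] by auto
    with * show ?pattern unfolding contains_pattern_def pat by blast
  qed
  then show ?thesis
    unfolding avoids_def subseq_triple_iff_nth by blast
qed

lemma finite_admissible: "finite {v. admissible g n v}"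
proof (rule finite_subset)
  show "{v. admissible g n v} \<subseteq> {v. set v \<subseteq> {1..n} \<and> length v = n}"
    by (auto simp: admissible_def dest: distinct_card)
qed (simp add: finite_lists_length_eq)

section \<open>Inserting the largest entry\<close>

text \<open>In every forbidden subsequence the first entry exceeds some or all later ones so that
  \<open>Suc n\<close> can only stand first. Those starting with it restrict \<open>ys\<close>
  alone, and all others already live in \<open>xs @ ys\<close>.\<close>

lemma admissible_Suc_iff:
  assumes g: "\<And>a b. (a, b) \<in> g \<Longrightarrow> a < b"
  shows "admissible g (Suc n) v \<longleftrightarrow>
    (\<exists>xs ys. v = xs @ Suc n # ys \<and> admissible g n (xs @ ys) \<and>
      length ys \<le> 1 \<and> (\<forall>y \<in> set ys. (y, Suc n) \<notin> g))"
proof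
  assume v: "admissible g (Suc n) v"
  then have "Suc n \<in> set v" by (simp add: admissible_def)
  then obtain xs ys where xy: "v = xs @ Suc n # ys" by (auto simp: in_set_conv_decomp)
  have new: "Suc n \<notin> set xs" "Suc n \<notin> set ys"
    using v xy by (auto simp: admissible_def)
  have set: "set (xs @ ys) = {1..n}"
  proof -
    have "insert (Suc n) (set (xs @ ys)) = insert (Suc n) {1..n}"
      using v xy by (auto simp: admissible_def)
    moreover have "Suc n \<notin> {1..n}" by simp
    ultimately show ?thesis using new by (metis Un_iff insert_ident set_append)
  qed
  have sub: "subseq us v" if "subseq us (xs @ ys)" for us
    using that xy by (auto elim!: subseq_order.trans intro: list_emb_append_mono)
  have "length ys \<le> 1"
  proof (rule ccontr)
    assume "\<not> length ys \<le> 1"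
    \<comment> \<open>The borrowed case rule merely splits lists into empty, singleton and at least
      two entries.\<close>
    then obtain b c zs where ys: "ys = b # c # zs"
      by (cases ys rule: remdups_adj.cases) auto
    then have "subseq [Suc n, b, c] v"
      unfolding xy by (intro list_emb_append2) auto
    moreover have "b \<in> set (xs @ ys)" "c \<in> set (xs @ ys)" using ys by simp_all
    then have "b < Suc n" "c < Suc n" unfolding set by auto
    ultimately show False using v by (simp add: admissible_def)
  qed
  moreover have "(y, Suc n) \<notin> g" if "y \<in> set ys" for y
  proof
    assume "(y, Suc n) \<in> g"
    then have "\<not> subseq [Suc n, y] v" using v by (simp add: admissible_def)
    then show False
      using that new by (simp add: xy subseq_Cons_append_new subseq_singleton_left)
  qed
  moreover have "distinct (xs @ ys)"
    using v by (simp add: admissible_def xy)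
  then have "admissible g n (xs @ ys)"
    using v set sub unfolding admissible_def by blast
  ultimately show "\<exists>xs ys. v = xs @ Suc n # ys \<and> admissible g n (xs @ ys) \<and>
      length ys \<le> 1 \<and> (\<forall>y \<in> set ys. (y, Suc n) \<notin> g)"
    using xy by blast
next
  assume "\<exists>xs ys. v = xs @ Suc n # ys \<and> admissible g n (xs @ ys) \<and>
      length ys \<le> 1 \<and> (\<forall>y \<in> set ys. (y, Suc n) \<notin> g)"
  then obtain xs ys where xy: "v = xs @ Suc n # ys" and w: "admissible g n (xs @ ys)"
    and len: "length ys \<le> 1" and ys: "\<forall>y \<in> set ys. (y, Suc n) \<notin> g" by blast
  have set: "set xs \<union> set ys = {1..n}" using w by (auto simp: admissible_def)
  then have "Suc n \<notin> set xs \<union> set ys" by simp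
  then have new: "Suc n \<notin> set xs" "Suc n \<notin> set ys" by simp_all
  have set_v: "set v = {1..Suc n}" using set by (auto simp: xy)
  have bound: "\<forall>x \<in> set us. x \<le> Suc n" if "subseq us v" for us
  proof
    fix x assume "x \<in> set us"
    with that obtain y where "y \<in> set v" "x = y" by (rule list_emb_set)
    then show "x \<le> Suc n" by (simp add: set_v)
  qed
  have "\<not> subseq [b, a] v" if "(a, b) \<in> g" for a b
  proof
    assume s: "subseq [b, a] v"
    have "a < b" using g that .
    moreover have "b \<le> Suc n" using bound[OF s] by simp
    ultimately have "a \<noteq> Suc n" by simp
    show False
    proof (cases "b = Suc n")
      case True
      then show False
        using s ys that new by (simp add: xy subseq_Cons_append_new subseq_singleton_left)
    next
      case False
      then have "subseq [b, a] (xs @ ys)"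
        using s \<open>a \<noteq> Suc n\<close> new by (simp add: xy subseq_insert_new)
      then show False using w that by (simp add: admissible_def)
    qed
  qed
  moreover have "\<not> subseq [a, b, c] v" if "b < a" "c < a" for a b c
  proof
    assume s: "subseq [a, b, c] v"
    then have "b \<noteq> Suc n" "c \<noteq> Suc n" using bound[OF s] that by auto
    show False
    proof (cases "a = Suc n")
      case True
      then have "subseq [b, c] ys"
        using s new by (simp add: xy subseq_Cons_append_new)
      then have "length [b, c] \<le> length ys" by (rule list_emb_length)
      then show False using len by simp
    next
      case False
      then have "subseq [a, b, c] (xs @ ys)"
        using s \<open>b \<noteq> Suc n\<close> \<open>c \<noteq> Suc n\<close> new by (simp add: xy subseq_insert_new)
      then show False using w that by (simp add: admissible_def)
    qed
  qed
  moreover have "distinct v" using w new by (simp add: xy admissible_def)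
  ultimately show "admissible g (Suc n) v" using set_v by (simp add: admissible_def)
qed

text \<open>The suffix \<open>ys\<close> is empty or consists of the last entry of \<open>w\<close>.
  The bound on \<open>n\<close> keeps \<open>w\<close> nonempty, so that \<open>last w\<close> is a
  genuine entry.\<close>

lemma admissible_Suc_cases:
  assumes "\<And>a b. (a, b) \<in> g \<Longrightarrow> a < b" and "n \<ge> 1"
  shows "admissible g (Suc n) v \<longleftrightarrow>
    (\<exists>w. admissible g n w \<and>
      (v = w @ [Suc n] \<or> v = butlast w @ [Suc n, last w] \<and> (last w, Suc n) \<notin> g))"
    (is "_ \<longleftrightarrow> ?R")
proof -
  have ne: "w \<noteq> []" if "admissible g n w" for w
    using that assms(2) by (auto simp: admissible_def)
  show ?thesis
  proof
    assume "admissible g (Suc n) v"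
    then obtain xs ys where xy: "v = xs @ Suc n # ys" "admissible g n (xs @ ys)"
      "length ys \<le> 1" "\<forall>y \<in> set ys. (y, Suc n) \<notin> g"
      using admissible_Suc_iff[OF assms(1)] by blast
    show ?R
    proof (cases ys)
      case Nil
      then show ?thesis using xy by auto
    next
      case (Cons y zs)
      then show ?thesis using xy by (intro exI[of _ "xs @ [y]"]) auto
    qed
  next
    assume ?R
    then obtain w where w: "admissible g n w" and
      "v = w @ [Suc n] \<or> v = butlast w @ [Suc n, last w] \<and> (last w, Suc n) \<notin> g" by blast
    then show "admissible g (Suc n) v"
    proof (elim disjE)
      assume "v = w @ [Suc n]"
      then show ?thesis
        using w admissible_Suc_iff[OF assms(1), of g n v] by fastforce
    next
      assume "v = butlast w @ [Suc n, last w] \<and> (last w, Suc n) \<notin> g"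
      then have "v = butlast w @ Suc n # [last w] \<and> admissible g n (butlast w @ [last w])
        \<and> length [last w] \<le> 1 \<and> (\<forall>y \<in> set [last w]. (y, Suc n) \<notin> g)"
        using w ne by simp
      then show ?thesis
        using admissible_Suc_iff[OF assms(1), of g n v] by blast
    qed
  qed
qed

section \<open>Recursion for the counts\<close>

definition adm_count :: "nat rel \<Rightarrow> nat \<Rightarrow> nat" where
  "adm_count g n = card {v. admissible g n v}"

text \<open>For \<open>n\<close> at least 2 these are the admissible lists with a descent at the
  end, \<open>n\<close> being second to last. Inside a tooth they are the ones that admit a second
  insertion.\<close>

definition adm_count_desc :: "nat rel \<Rightarrow> nat \<Rightarrow> nat" where
  "adm_count_desc g n = card {v. admissible g n v \<and> last v \<noteq> n}"

lemma admissible_1_iff: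
  assumes "\<And>a b. (a, b) \<in> g \<Longrightarrow> a < b"
  shows "admissible g 1 v \<longleftrightarrow> v = [1]"
proof
  assume v: "admissible g 1 v"
  then have "length v = 1" using distinct_card[of v] by (simp add: admissible_def)
  then show "v = [1]" using v by (cases v) (auto simp: admissible_def)
next
  assume "v = [1]"
  then show "admissible g 1 v"
    by (auto simp: admissible_def subseq_Cons_iff_nth)
qed

text \<open>Appending \<open>Suc n\<close> yields the lists that end in it, inserting it before the
  last entry yields the others, and both insertions are injective.\<close>

lemma adm_count_Suc:
  assumes g: "\<And>a b. (a, b) \<in> g \<Longrightarrow> a < b" and n: "n \<ge> 1"
  shows "adm_count_desc g (Suc n) = card {w. admissible g n w \<and> (last w, Suc n) \<notin> g}" (is ?desc)
    and "adm_count g (Suc n) = adm_count g n + adm_count_desc g (Suc n)" (is ?total)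
proof -
  have ne: "w \<noteq> []" "last w \<noteq> Suc n" if "admissible g n w" for w
  proof -
    show "w \<noteq> []" using that n by (auto simp: admissible_def)
    then have "last w \<in> {1..n}" using that last_in_set by (auto simp: admissible_def)
    then show "last w \<noteq> Suc n" by auto
  qed
  define f where "f = (\<lambda>w. butlast w @ [Suc n, last w])"
  have "{v. admissible g (Suc n) v \<and> last v \<noteq> Suc n} =
      f ` {w. admissible g n w \<and> (last w, Suc n) \<notin> g}"
    using ne by (auto simp: admissible_Suc_cases[OF g n] f_def)
  \<comment> \<open>\<open>f w\<close> reveals \<open>butlast w\<close> and \<open>last w\<close>,
    which determine the nonempty list \<open>w\<close>.\<close>
  moreover have "inj_on f {w. admissible g n w \<and> (last w, Suc n) \<notin> g}"
    using ne by (intro inj_onI) (metis append_butlast_last_id append_eq_conv_conj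
        append_eq_append_conv f_def length_Cons list.inject mem_Collect_eq)
  ultimately show ?desc by (simp add: adm_count_desc_def card_image)
  have "{v. admissible g (Suc n) v \<and> last v = Suc n} = (\<lambda>w. w @ [Suc n]) ` {w. admissible g n w}"
    using ne by (auto simp: admissible_Suc_cases[OF g n])
  then have "card {v. admissible g (Suc n) v \<and> last v = Suc n} = adm_count g n"
    by (simp add: adm_count_def card_image inj_on_def)
  moreover have "{v. admissible g (Suc n) v} =
      {v. admissible g (Suc n) v \<and> last v = Suc n} \<union> {v. admissible g (Suc n) v \<and> last v \<noteq> Suc n}"
    by auto
  then have "adm_count g (Suc n) =
      card {v. admissible g (Suc n) v \<and> last v = Suc n} + adm_count_desc g (Suc n)"
    unfolding adm_count_def adm_count_desc_def
    using finite_subset[OF _ finite_admissible[of g "Suc n"]]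
    by (simp only:) (intro card_Un_disjoint; auto)
  ultimately show ?total by simp
qed

section \<open>Counting along the comb\<close>

context
  fixes s t :: nat and g :: "nat rel"
  assumes t: "t \<ge> 2"
  defines "g \<equiv> comb_spine s t \<union> comb_teeth s t"
begin

lemma generators_less: "(a, b) \<in> g \<Longrightarrow> a < b"
  using t by (auto simp: g_def comb_spine_def comb_teeth_def)

text \<open>Targets of spine relations are congruent to 1 modulo \<open>t\<close>, so only a tooth
  relation can end here.\<close>

lemma generator_inside_tooth_iff:
  assumes "c < s" "1 \<le> j" "j < t"
  shows "(a, Suc (c * t + j)) \<in> g \<longleftrightarrow> a = c * t + j"
proof -
  have "(a, Suc (c * t + j)) \<notin> comb_spine s t"
  proof
    assume "(a, Suc (c * t + j)) \<in> comb_spine s t"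
    then obtain c' where "c * t + j = (c' + 1) * t" by (auto simp: comb_spine_def)
    then have "(c * t + j) mod t = ((c' + 1) * t) mod t" by simp
    then show False using assms by simp
  qed
  moreover have "(a, Suc (c * t + j)) \<in> comb_teeth s t \<longleftrightarrow> a = c * t + j"
    using assms unfolding comb_teeth_def by force
  ultimately show ?thesis by (simp add: g_def)
qed

text \<open>Only a spine relation ends at the start of a tooth, and its source is the start of the
  previous tooth. Hence the source is neither of the last entries that
  \<open>admissible_last\<close> allows.\<close>

lemma generator_new_tooth_dest:
  assumes "(a, Suc (c * t)) \<in> g"
  shows "a < c * t" and "\<not> t dvd a"
proof -
  have "(a, Suc (c * t)) \<notin> comb_teeth s t"
  proof
    assume "(a, Suc (c * t)) \<in> comb_teeth s t"
    then obtain c' j where j: "c * t = c' * t + j" "1 \<le> j" "j < t"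
      by (auto simp: comb_teeth_def)
    from j(1) have "(c' * t + j) mod t = 0" by (metis mod_mult_self2_is_0)
    then show False using j(2,3) by simp
  qed
  then obtain c' where *: "a = c' * t + 1" "c * t = (c' + 1) * t"
    using assms by (auto simp: g_def comb_spine_def)
  then show "a < c * t" using t by simp
  show "\<not> t dvd a"
  proof
    assume "t dvd a"
    then have "t dvd 1" using *(1) by (metis dvd_add_right_iff dvd_triv_right)
    then show False using t by simp
  qed
qed

text \<open>Appending makes the new maximum last. Inserting before the last entry keeps that entry,
  and if it is \<open>n\<close>, then \<open>n\<close> is not covered by \<open>Suc n\<close> and
  must be the tip of a tooth, a multiple of \<open>t\<close>.\<close>

lemma admissible_last:
  assumes "admissible g n v" "1 \<le> n" "n \<le> s * t"
  shows "last v = n \<or> t dvd last v"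
  using assms(2,1,3)
proof (induction n arbitrary: v rule: dec_induct)
  case base
  then have "v = [1]" using admissible_1_iff[OF generators_less] by blast
  then show ?case by simp
next
  case (step n)
  from admissible_Suc_cases[OF generators_less step.hyps(1)] step.prems(1)
  obtain w where w: "admissible g n w" and
    v: "v = w @ [Suc n] \<or> v = butlast w @ [Suc n, last w] \<and> (last w, Suc n) \<notin> g" by blast
  show ?case
  proof (cases "v = w @ [Suc n]")
    case False
    then have last: "last v = last w" "(last w, Suc n) \<notin> g" using v by auto
    \<comment> \<open>Otherwise \<open>n\<close> sits at position \<open>n mod t\<close> of tooth
      \<open>n div t\<close>, below the tip, and is related to \<open>Suc n\<close>.\<close>
    have "t dvd n" if "last w = n"
    proof (rule ccontr)
      assume "\<not> t dvd n"
      then have "1 \<le> n mod t" "n mod t < t" using t by (auto simp: mod_greater_zero_iff_not_dvd Suc_leI)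
      moreover have "n div t < s" using step.prems(2) t by (simp add: less_mult_imp_div_less)
      ultimately have "(n, Suc n) \<in> g"
        using generator_inside_tooth_iff[of "n div t" "n mod t" n] by simp
      then show False using last that by simp
    qed
    then show ?thesis using step.IH[OF w] step.prems(2) last by auto
  qed simp
qed

text \<open>The only generator into the new entry comes from the current maximum, so the second
  insertion is open exactly to lists not ending in it.\<close>

lemma adm_count_inside_tooth:
  assumes "c < s" "1 \<le> j" "j < t"
  shows "adm_count_desc g (Suc (c * t + j)) = adm_count_desc g (c * t + j)"
    and "adm_count g (Suc (c * t + j)) = adm_count g (c * t + j) + adm_count_desc g (c * t + j)"
  using assms
  by (simp_all add: adm_count_Suc[OF generators_less] generator_inside_tooth_iff)
    (simp_all add: adm_count_desc_def)

text \<open>No possible last entry is the source of the spine relation, so both insertions work for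
  every list.\<close>

lemma adm_count_new_tooth:
  assumes "1 \<le> c" "c < s"
  shows "adm_count_desc g (Suc (c * t)) = adm_count g (c * t)"
    and "adm_count g (Suc (c * t)) = 2 * adm_count g (c * t)"
proof -
  have pos: "1 \<le> c * t" using assms t by simp
  have le: "c * t \<le> s * t" using assms by simp
  have "(last w, Suc (c * t)) \<notin> g" if "admissible g (c * t) w" for w
    using admissible_last[OF that pos le] generator_new_tooth_dest[of "last w" c] by auto
  then have "{w. admissible g (c * t) w \<and> (last w, Suc (c * t)) \<notin> g} = {w. admissible g (c * t) w}"
    by auto
  then show "adm_count_desc g (Suc (c * t)) = adm_count g (c * t)"
    using adm_count_Suc(1)[OF generators_less pos] by (simp add: adm_count_def)
  then show "adm_count g (Suc (c * t)) = 2 * adm_count g (c * t)"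
    using adm_count_Suc(2)[OF generators_less pos] by simp
qed

text \<open>The first tooth is a chain: starting from \<open>[1]\<close>, which ends in its maximum,
  the second insertion is never available.\<close>

lemma adm_count_first_tooth:
  assumes "1 \<le> s" "1 \<le> j" "j \<le> t"
  shows "adm_count g j = 1 \<and> adm_count_desc g j = 0"
  using assms(2,3)
proof (induction j rule: dec_induct)
  case base
  have "{v. admissible g (Suc 0) v} = {[1]}"
    "{v. admissible g (Suc 0) v \<and> last v \<noteq> Suc 0} = {}"
    using admissible_1_iff[OF generators_less] by auto
  then show ?case by (simp add: adm_count_def adm_count_desc_def)
next
  case (step j)
  then show ?case using adm_count_inside_tooth[of 0 j] assms(1) by simp
qed

text \<open>The start of the tooth doubles the count, and each later entry adds the constant number
  of lists not ending in their maximum.\<close>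

lemma adm_count_tooth:
  assumes "1 \<le> c" "c < s" "1 \<le> j" "j \<le> t"
  shows "adm_count g (c * t + j) = (j + 1) * adm_count g (c * t) \<and>
    adm_count_desc g (c * t + j) = adm_count g (c * t)"
  using assms(3,4)
proof (induction j rule: dec_induct)
  case base
  then show ?case using adm_count_new_tooth[OF assms(1,2)] by simp
next
  case (step j)
  then show ?case using adm_count_inside_tooth[of c j] assms(2) by simp
qed

text \<open>The first tooth contributes the factor 1 and each later one \<open>t + 1\<close>, whence
  the exponent \<open>c - 1\<close>.\<close>

lemma adm_count_comb:
  assumes "1 \<le> c" "c \<le> s"
  shows "adm_count g (c * t) = (t + 1) ^ (c - 1)"
  using assms
proof (induction c rule: dec_induct)
  case base
  then show ?case using adm_count_first_tooth[of t] t by simp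
next
  case (step c)
  then have "adm_count g (Suc c * t) = (t + 1) * (t + 1) ^ (c - 1)"
    using adm_count_tooth[of c t] t by (simp add: add.commute)
  then show ?case using step.hyps by (cases c) simp_all
qed

end

theorem theorem22:
  fixes s t :: nat
  assumes "s \<ge> 1" and "t \<ge> 2"
  shows "card {v. linear_extension (comb_carrier s t) (comb_order s t) v
                    \<and> avoids v [3, 1, 2] \<and> avoids v [3, 2, 1]}
           = (t + 1) ^ (s - 1)"
proof -
  let ?g = "comb_spine s t \<union> comb_teeth s t"
  have "?g \<subseteq> comb_carrier s t \<times> comb_carrier s t"
    using assms(2) by (intro comb_generators_subset) simp
  moreover have "irrefl ?g"
    using generators_less[OF assms(2)] by (auto simp: irrefl_def)
  \<comment> \<open>Either side of the equivalence makes \<open>v\<close> distinct, as the pattern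
    criterion requires.\<close>
  ultimately have "linear_extension (comb_carrier s t) (comb_order s t) v
      \<and> avoids v [3, 1, 2] \<and> avoids v [3, 2, 1] \<longleftrightarrow> admissible ?g (s * t) v" for v
    using avoids_312_321_iff[of v]
    by (auto simp: comb_order_def linear_extension_generators admissible_def comb_carrier_def)
  then have "card {v. linear_extension (comb_carrier s t) (comb_order s t) v
      \<and> avoids v [3, 1, 2] \<and> avoids v [3, 2, 1]} = adm_count ?g (s * t)"
    by (simp add: adm_count_def)
  also have "\<dots> = (t + 1) ^ (s - 1)"
    using adm_count_comb[OF assms(2) assms(1) order_refl] .
  finally show ?thesis .
qed

end
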